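(* Let $\mu$ be a nontrivial probability measure on $\mathbb{C}$ with $\int|z|^j\,d\mu(z)<\infty$ for all $j=0,1,2,\dots$, and let $\Phi_n$ be its monic orthogonal polynomials. Suppose $z_0$ is an isolated point of $\operatorname{supp}(d\mu)$. Let $\Gamma=\operatorname{supp}(d\mu)\setminus\{z_0\}$ and let $\operatorname{ch}(\Gamma)$ be the convex hull of $\Gamma$. Suppose $\delta\equiv\operatorname{dist}(z_0,\operatorname{ch}(\Gamma))>0$. Then $\Phi_n$ has at most one zero in $\{z\mid|z-z_0|<\delta/3\}$.
   Context: A probability measure is nontrivial if it is not a finite combination of delta functions. $\Phi_n$ is the monic polynomial of degree $n$ orthogonal in $L^2(\mathbb{C},d\mu)$ to $1,z,\dots,z^{n-1}$. *)

theory Defs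
  imports "HOL-Probability.Probability" "HOL-Computational_Algebra.Polynomial"
begin

definition msupport :: "'a::topological_space measure \<Rightarrow> 'a set" where
  "msupport M = {x. \<forall>U. open U \<and> x \<in> U \<longrightarrow> emeasure M U > 0}"

definition finite_delta_combination :: "complex measure \<Rightarrow> bool" where
  "finite_delta_combination M \<longleftrightarrow>
     (\<exists>S c. finite S \<and>
        (\<forall>A\<in>sets borel. measure M A = (\<Sum>x\<in>S. (c x :: real) * measure (return borel x) A)))"

definition nontrivial_measure :: "complex measure \<Rightarrow> bool" where
  "nontrivial_measure M \<longleftrightarrow> \<not> finite_delta_combination M"

definition L2_inner :: "complex measure \<Rightarrow> (complex \<Rightarrow> complex) \<Rightarrow> (complex \<Rightarrow> complex) \<Rightarrow> complex" where
  "L2_inner M f g = (\<integral>z. cnj (f z) * g z \<partial>M)"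

(* For a nontrivial measure with finite moments of all orders there is exactly one such P
   for each n. (The Bochner integral of a non-integrable function is 0, so the orthogonality
   condition carries its usual meaning only when the moments are finite.) *)
definition monic_orthogonal_poly :: "complex measure \<Rightarrow> nat \<Rightarrow> complex poly \<Rightarrow> bool" where
  "monic_orthogonal_poly M n P \<longleftrightarrow>
     degree P = n \<and> lead_coeff P = 1 \<and> (\<forall>k<n. L2_inner M (\<lambda>z. z ^ k) (poly P) = 0)"

end

theory Submission
  imports Defs
begin

text \<open>If \<open>\<Phi>\<^sub>n(z) = (z - a) (z - b) q(z)\<close> with \<open>a\<close> and \<open>b\<close> close to \<open>z\<^sub>0\<close>, test the orthogonality
  against \<open>(z - z\<^sub>0) q(z)\<close>, which has degree \<open>n - 1\<close> and vanishes at \<open>z\<^sub>0\<close>.  With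
  \<open>\<zeta> = z - z\<^sub>0\<close> this says that \<open>cnj \<zeta> (z - a) (z - b)\<close> has integral \<open>0\<close> against
  \<open>\<bar>q\<bar>\<^sup>2 d\<mu>\<close>.  For the unit vector \<open>u\<close> pointing from \<open>z\<^sub>0\<close> to the nearest point of the closed convex
  hull of \<open>\<Gamma>\<close>, the component of that function in direction \<open>u\<close> is positive on \<open>\<Gamma>\<close>: it is
  \<open>\<bar>\<zeta>\<bar>\<^sup>2 (u \<bullet> \<zeta>) \<ge> \<bar>\<zeta>\<bar>\<^sup>2 \<delta>\<close> up to an error of at most
  \<open>\<bar>\<zeta>\<bar>\<^sup>2 (2\<delta>/3) + \<bar>\<zeta>\<bar> (\<delta>/3)\<^sup>2\<close>.  Hence \<open>\<mu>\<close> lives on \<open>z\<^sub>0\<close> and the finitely many zeros of \<open>q\<close>,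
  contradicting nontriviality.\<close>

text \<open>Each point outside the support has an open null neighbourhood; by Lindelof countably
  many open null sets cover the complement, which is therefore null.\<close>

lemma AE_in_msupport:
  fixes M :: "'a::second_countable_topology measure"
  assumes "sets M = sets borel"
  shows "AE x in M. x \<in> msupport M"
proof -
  define F where "F = {U :: 'a set. open U \<and> emeasure M U = 0}"
  obtain F' where F': "F' \<subseteq> F" "countable F'" "\<Union>F' = \<Union>F"
    using Lindelof[of F] by (auto simp: F_def)
  have "U \<in> null_sets M" if "U \<in> F'" for U
    using that F'(1) assms by (auto simp: F_def null_sets_def)
  then have "\<Union>F' \<in> null_sets M"
    using null_sets_UN'[OF F'(2), of "\<lambda>U. U" M] by simp
  moreover have "{x \<in> space M. x \<notin> msupport M} \<subseteq> \<Union>F'"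
    by (auto simp: F' F_def msupport_def)
  ultimately show ?thesis by (rule AE_I')
qed

lemma finite_delta_combination_if_AE_finite:
  assumes "finite_measure M" "sets M = sets borel" "finite S" "AE x in M. x \<in> S"
  shows "finite_delta_combination M"
  unfolding finite_delta_combination_def
proof (intro exI[of _ S] exI[of _ "\<lambda>x. measure M {x}"] conjI ballI)
  interpret finite_measure M by fact
  fix A :: "complex set" assume A: "A \<in> sets borel"
  have fin: "F \<in> sets M" if "finite F" for F
    unfolding assms(2) using that by (intro borel_closed finite_imp_closed)
  have "measure M A = measure M (A \<inter> S)"
  proof (rule measure_eq_AE)
    show "AE x in M. x \<in> A \<longleftrightarrow> x \<in> A \<inter> S" using assms(4) by eventually_elim simp
    show "A \<in> sets M" using A assms(2) by simp
    show "A \<inter> S \<in> sets M" using assms(3) by (intro fin) simp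
  qed
  also have "\<dots> = (\<Sum>x\<in>A \<inter> S. measure M {x})"
    using assms(3) fin by (intro finite_measure_eq_sum_singleton) simp_all
  also have "\<dots> = (\<Sum>x\<in>S. measure M {x} * measure (return borel x) A)"
    using A assms(3) by (intro sum.mono_neutral_cong_left) (auto simp: measure_return indicator_def)
  finally show "measure M A = (\<Sum>x\<in>S. measure M {x} * measure (return borel x) A)" .
qed fact

text \<open>The vector \<open>u\<close> is normal to the supporting hyperplane at the point of
  \<open>closure S\<close> nearest to \<open>z\<close>. Passing to the closure supplies such a point
  and leaves the distance unchanged.\<close>

lemma inner_ge_infdist_convex:
  fixes S :: "'a::euclidean_space set"
  assumes "convex S" "infdist z S > 0"
  obtains u where "norm u = 1" "\<And>x. x \<in> S \<Longrightarrow> infdist z S \<le> u \<bullet> (x - z)"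
proof -
  define d c where "d = infdist z S" and "c = closest_point (closure S) z"
  \<comment> \<open>\<open>infdist\<close> to the empty set is 0 by convention, so a positive value
    rules it out.\<close>
  have "S \<noteq> {}" using assms(2) by (auto simp: infdist_def)
  have c: "c \<in> closure S" "\<And>y. y \<in> closure S \<Longrightarrow> dist z c \<le> dist z y"
    unfolding c_def using closest_point_exists[of "closure S" z] \<open>S \<noteq> {}\<close> by auto
  have d: "d = norm (c - z)"
  proof (rule antisym)
    show "d \<le> norm (c - z)"
      using infdist_triangle[of z S c] c(1) \<open>S \<noteq> {}\<close>
      by (simp add: d_def in_closure_iff_infdist_zero dist_norm norm_minus_commute)
    have "dist z c \<le> d" unfolding d_def infdist_notempty[OF \<open>S \<noteq> {}\<close>]
      by (rule cINF_greatest[OF \<open>S \<noteq> {}\<close>]) (use c(2) closure_subset in blast)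
    then show "norm (c - z) \<le> d" by (simp add: dist_norm norm_minus_commute)
  qed
  show ?thesis
  proof (rule that[of "(c - z) /\<^sub>R d"])
    show "norm ((c - z) /\<^sub>R d) = 1" using assms(2) d by (simp flip: d_def)
  next
    fix x assume x: "x \<in> S"
    \<comment> \<open>Seen from the nearest point of a convex set, \<open>z\<close> and any point of
      the set never span an acute angle.\<close>
    have "(z - c) \<bullet> (x - c) \<le> 0"
      unfolding c_def using x closure_subset assms(1)
      by (intro closest_point_dot) auto
    moreover have "(c - z) \<bullet> (x - z) = (c - z) \<bullet> (c - z) - (z - c) \<bullet> (x - c)"
      by (simp add: inner_diff_left inner_diff_right inner_commute)
    ultimately have "d * d \<le> (c - z) \<bullet> (x - z)"
      by (simp add: d flip: power2_eq_square dot_square_norm)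
    then show "infdist z S \<le> ((c - z) /\<^sub>R d) \<bullet> (x - z)"
      unfolding inner_scaleR_left using assms(2) by (simp add: field_simps flip: d_def)
  qed
qed

text \<open>\<open>proots\<close> counts multiplicities, so \<open>a\<close> and \<open>b\<close>
  may coincide; hence the second root is sought in the quotient \<open>r\<close>.\<close>

lemma two_proots_in_factor:
  fixes p :: "'a::idom poly"
  assumes "size (filter_mset Q (proots p)) > 1"
  obtains a b q where "Q a" "Q b" "p = [:-a, 1:] * ([:-b, 1:] * q)" "q \<noteq> 0"
proof -
  have p: "p \<noteq> 0" using assms by auto
  from assms have "filter_mset Q (proots p) \<noteq> {#}"
    unfolding nonempty_has_size by linarith
  then obtain a where a: "a \<in># filter_mset Q (proots p)" by (rule multiset_nonemptyE)
  then have "poly p a = 0" using p by auto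
  then obtain r where r: "p = [:-a, 1:] * r" by (auto simp: poly_eq_0_iff_dvd)
  with p have "r \<noteq> 0" by auto
  then have "proots p = {#a#} + proots r"
    using r p by (simp add: proots_mult del: mult_pCons_left)
  moreover have "Q a" using a by simp
  ultimately have "filter_mset Q (proots r) \<noteq> {#}"
    using assms unfolding nonempty_has_size by simp
  then obtain b where b: "b \<in># filter_mset Q (proots r)"
    by (rule multiset_nonemptyE)
  then have "poly r b = 0" using \<open>r \<noteq> 0\<close> by auto
  then obtain q where q: "r = [:-b, 1:] * q" by (auto simp: poly_eq_0_iff_dvd)
  show ?thesis
  proof (rule that[of a b q])
    show "p = [:-a, 1:] * ([:-b, 1:] * q)" using r q by metis
    show "q \<noteq> 0" using q \<open>r \<noteq> 0\<close> by (metis mult_zero_right)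
  qed (use b \<open>Q a\<close> in simp_all)
qed

lemma poly_inner_integrable:
  assumes "sets M = sets borel" "\<And>j::nat. integrable M (\<lambda>z::complex. norm z ^ j)"
  shows "integrable M (\<lambda>z. cnj (poly p z) * poly q z)"
proof -
  \<comment> \<open>The modulus of the integrand is exactly \<open>norm z ^ (i + j)\<close>.\<close>
  have "integrable M (\<lambda>z. cnj z ^ i * z ^ j)" for i j
    by (rule Bochner_Integration.integrable_bound[OF assms(2)[of "i + j"]])
       (auto simp: norm_mult norm_power power_add measurable_cong_sets[OF assms(1) refl]
         intro!: borel_measurable_continuous_onI continuous_on_mult continuous_on_power
           continuous_on_cnj continuous_on_id)
  then have "integrable M (\<lambda>z. \<Sum>i\<le>degree p. \<Sum>j\<le>degree q.
      (cnj (coeff p i) * coeff q j) * (cnj z ^ i * z ^ j))"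
    by (intro Bochner_Integration.integrable_sum integrable_mult_right)
  then show ?thesis
    unfolding poly_altdef cnj_sum sum_product by (simp add: mult_ac)
qed

lemma monic_orthogonal_poly_degree_less:
  assumes "sets M = sets borel" "\<And>j::nat. integrable M (\<lambda>z::complex. norm z ^ j)"
    and "monic_orthogonal_poly M n P" "degree p < n"
  shows "L2_inner M (poly p) (poly P) = 0"
proof -
  have int: "integrable M (\<lambda>z. cnj z ^ i * poly P z)" for i
    using poly_inner_integrable[OF assms(1,2), of "monom 1 i" P] by (simp add: poly_monom)
  have "L2_inner M (poly p) (poly P)
      = (\<integral>z. (\<Sum>i\<le>degree p. cnj (coeff p i) * (cnj z ^ i * poly P z)) \<partial>M)"
    unfolding L2_inner_def by (simp add: poly_altdef[of p] sum_distrib_right mult.assoc)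
  also have "\<dots> = (\<Sum>i\<le>degree p. cnj (coeff p i) * L2_inner M (\<lambda>z. z ^ i) (poly P))"
    using int by (simp add: Bochner_Integration.integral_sum L2_inner_def)
  also have "\<dots> = 0"
    using assms(3,4) by (intro sum.neutral) (auto simp: monic_orthogonal_poly_def)
  finally show ?thesis .
qed

text \<open>This is the pointwise estimate with \<open>z0\<close> moved to the origin. The errors
  add up to at most 2/3 + 1/9 = 7/9 of the lower bound \<open>r\<^sup>2 * \<delta>\<close> for the
  main term.\<close>

lemma inner_cnj_mult_pos:
  fixes u \<zeta> a b :: complex
  assumes "norm u = 1" "\<delta> > 0" "\<delta> \<le> u \<bullet> \<zeta>" "norm a < \<delta> / 3" "norm b < \<delta> / 3"
  shows "u \<bullet> (cnj \<zeta> * (\<zeta> - a) * (\<zeta> - b)) > 0"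
proof -
  define r where "r = norm \<zeta>"
  have le: "u \<bullet> w \<le> norm w" for w
    using Cauchy_Schwarz_ineq2[of u w] assms(1) by simp
  have r: "\<delta> \<le> r" using le[of \<zeta>] assms(3) by (simp add: r_def)
  have eq: "cnj \<zeta> * (\<zeta> - a) * (\<zeta> - b) = r\<^sup>2 *\<^sub>R \<zeta> - (r\<^sup>2 *\<^sub>R (a + b) - cnj \<zeta> * (a * b))"
    unfolding r_def scaleR_conv_of_real complex_norm_square of_real_power[symmetric]
    by (simp add: algebra_simps)
  have "norm (a * b) \<le> (\<delta> / 3) * (\<delta> / 3)"
    unfolding norm_mult using assms by (intro mult_mono) auto
  then have "norm (cnj \<zeta> * (a * b)) \<le> r * (\<delta> * \<delta> / 9)"
    unfolding norm_mult[of "cnj \<zeta>"] by (intro mult_mono) (auto simp: r_def)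
  \<comment> \<open>One factor \<delta> is traded for \<open>r\<close>, so that both errors scale
    with \<open>r\<^sup>2\<close>.\<close>
  moreover have "r * (\<delta> * \<delta> / 9) \<le> r\<^sup>2 * (\<delta> / 9)"
    using r assms(2) by (simp add: power2_eq_square)
  moreover have "norm (r\<^sup>2 *\<^sub>R (a + b)) \<le> r\<^sup>2 * (2 * \<delta> / 3)"
    unfolding norm_scaleR using norm_triangle_ineq[of a b] assms by (intro mult_mono) auto
  ultimately have "u \<bullet> (r\<^sup>2 *\<^sub>R (a + b) - cnj \<zeta> * (a * b)) \<le> r\<^sup>2 * (2 * \<delta> / 3) + r\<^sup>2 * (\<delta> / 9)"
    using le[of "r\<^sup>2 *\<^sub>R (a + b) - cnj \<zeta> * (a * b)"]
      norm_triangle_ineq4[of "r\<^sup>2 *\<^sub>R (a + b)" "cnj \<zeta> * (a * b)"] by linarith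
  moreover have "u \<bullet> (r\<^sup>2 *\<^sub>R \<zeta>) \<ge> r\<^sup>2 * \<delta>"
    using assms(3) by (simp add: mult_left_mono)
  moreover have "r\<^sup>2 * \<delta> > 0" using r assms(2) by simp
  ultimately show ?thesis
    unfolding eq inner_diff_right[of u "r\<^sup>2 *\<^sub>R \<zeta>"] by argo
qed

theorem theorem4p3:
  fixes M :: "complex measure" and \<Phi> :: "nat \<Rightarrow> complex poly"
    and z0 :: complex and \<Gamma> :: "complex set" and \<delta> :: real and n :: nat
  assumes "prob_space M" and "sets M = sets borel"
    and "nontrivial_measure M"
    and "\<And>j::nat. integrable M (\<lambda>z. norm z ^ j)"
    and "\<And>m. monic_orthogonal_poly M m (\<Phi> m)"
    and "z0 isolated_in msupport M"
    and "\<Gamma> = msupport M - {z0}"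
    and "\<delta> = infdist z0 (convex hull \<Gamma>)"
    and "\<delta> > 0"
  shows "size (filter_mset (\<lambda>z. norm (z - z0) < \<delta> / 3) (proots (\<Phi> n))) \<le> 1"
proof (rule ccontr)
  interpret prob_space M by fact
  assume "\<not> ?thesis"
  then have "size (filter_mset (\<lambda>z. norm (z - z0) < \<delta> / 3) (proots (\<Phi> n))) > 1" by simp
  then obtain a b q where a: "norm (a - z0) < \<delta> / 3" and b: "norm (b - z0) < \<delta> / 3"
    and \<Phi>: "\<Phi> n = [:-a, 1:] * ([:-b, 1:] * q)" and q: "q \<noteq> 0"
    by (rule two_proots_in_factor)
  obtain u where u: "norm u = 1" "\<And>z. z \<in> convex hull \<Gamma> \<Longrightarrow> \<delta> \<le> u \<bullet> (z - z0)"
    using inner_ge_infdist_convex[of "convex hull \<Gamma>" z0] assms(8,9) by auto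
  define f where "f = (\<lambda>z. cnj (z - z0) * (z - a) * (z - b))"
  \<comment> \<open>The estimate is applied to \<open>z - z0\<close>, \<open>a - z0\<close> and
    \<open>b - z0\<close>; the shifts cancel in the differences.\<close>
  have pos: "u \<bullet> f z > 0" if "z \<in> \<Gamma>" for z
    using inner_cnj_mult_pos[OF u(1) assms(9) u(2)[OF hull_inc[OF that]] a b] by (simp add: f_def)
  define h where "h = [:-z0, 1:] * q"
  define g where "g = (\<lambda>z. cnj (poly h z) * poly (\<Phi> n) z)"
  have g_eq: "g z = (norm (poly q z))\<^sup>2 *\<^sub>R f z" for z
  proof -
    have lin: "poly [:-c, 1:] z = z - c" for c by simp
    show ?thesis
      unfolding scaleR_conv_of_real complex_norm_square g_def h_def \<Phi> f_def poly_mult lin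
        complex_cnj_mult by (simp only: mult_ac)
  qed
  have deg: "degree ([:-c, 1:] * p) = Suc (degree p)" if "p \<noteq> 0" for c :: complex and p
    using that by (subst degree_mult_eq) auto
  have "[:-b, 1:] * q \<noteq> 0" using q by (metis mult_eq_0_iff pCons_eq_0_iff one_neq_zero)
  then have "degree (\<Phi> n) = Suc (degree h)" unfolding h_def \<Phi>
    using q by (simp only: deg[OF q] deg[OF \<open>_ * q \<noteq> 0\<close>])
  moreover have "degree (\<Phi> n) = n" using assms(5) by (simp add: monic_orthogonal_poly_def)
  ultimately have "degree h < n" by simp
  then have "L2_inner M (poly h) (poly (\<Phi> n)) = 0"
    by (intro monic_orthogonal_poly_degree_less[OF assms(2,4,5)])
  then have "(\<integral>z. g z \<partial>M) = 0" by (simp add: L2_inner_def g_def)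
  \<comment> \<open>Integrability lets the inner product with \<open>u\<close> pass through the
    integral.\<close>
  moreover have int: "integrable M g"
    unfolding g_def by (rule poly_inner_integrable[OF assms(2,4)])
  ultimately have zero: "(\<integral>z. u \<bullet> g z \<partial>M) = 0" by simp
  have supp: "AE z in M. z \<in> msupport M" by (rule AE_in_msupport[OF assms(2)])
  \<comment> \<open>At \<open>z0\<close>, which \<open>pos\<close> does not cover, the linear factor
    of \<open>h\<close> makes \<open>g\<close> vanish.\<close>
  have nonneg: "u \<bullet> g z \<ge> 0" if "z \<in> msupport M" for z
  proof (cases "z = z0")
    case False
    then show ?thesis using pos[of z] that assms(7) by (simp add: g_eq)
  qed (simp add: g_def h_def)
  have "AE z in M. u \<bullet> g z = 0"
    using zero int nonneg supp by (subst (asm) integral_nonneg_eq_0_iff_AE) auto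
  \<comment> \<open>On \<Gamma> the factor \<open>u \<bullet> f z\<close> is strictly positive, so
    the weight \<open>(norm (poly q z))\<^sup>2\<close> must vanish.\<close>
  then have "AE z in M. z \<in> insert z0 {z. poly q z = 0}"
    using supp
  proof eventually_elim
    case (elim z)
    then show ?case using pos[of z] assms(7) by (auto simp: g_eq)
  qed
  then have "finite_delta_combination M"
    by (rule finite_delta_combination_if_AE_finite[OF finite_measure_axioms assms(2), rotated])
       (simp add: poly_roots_finite[OF q])
  then show False using assms(3) by (simp add: nontrivial_measure_def)
qed

end
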